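(* Let $\mathcal{M}$ be the class of matroids and let $f:\mathcal{M}\to\mathbb{Z}[x,y]$ be a function. Then $f$ is a $q$-Tutte–Grothendieck invariant (with $q=1$) if and only if $f$ is a Tutte–Grothendieck invariant.
   Context: A matroid is $M=(\mathcal{L},r)$, where $\mathcal{L}$ is the lattice of all subsets of a finite set $S$ (ordered by inclusion, $\mathbf{0}=\emptyset$, $\mathbf{1}=S$), and $r:\mathcal{L}\to\mathbb{Z}_{\ge0}$ satisfies $0\le r(x)\le |x|$, monotonicity and submodularity. For $a\le b$ the minor $M([a,b])$ is $([a,b],r_{[a,b]})$ with $r_{[a,b]}(x)=r(x)-r(a)$, regarded as a matroid via the isomorphism of $[a,b]$ with the Boolean lattice on $b\setminus a$. Put $M(a):=M([\mathbf{0},a])$, $M/a:=M([a,\mathbf{1}])$, $M-a:=M([\mathbf{0},a^c])$, with $a^c$ the complement of $a$. Matroids $M_1,M_2$ are equivalent, $M_1\cong M_2$, if there is a lattice isomorphism $\varphi:\mathcal{L}_1\to\mathcal{L}_2$ with $r_1(x)=r_2(\varphi(x))$ for all $x$. Atoms are singletons; coatoms are complements of singletons. An element $x$ is independent if $r(x)=|x|$. A loop is an atom of rank $0$. An isthmus is an atom $e$ such that $e\le y$ for every $y\in\mathcal{L}$ with $r(y)=r(\mathbf{1})$. A coloop is a coatom $x$ with $r(x)=r(\mathbf{1})-1$. A diamond is an interval $[a,b]$ with $|b\setminus a|=2$; it is prime if $r(x)-r(a)=1$ and $r(b)-r(x)=0$ for every $a<x<b$. $M$ is prime-free if $\mathcal{L}$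 contains no prime diamond. $f$ is a Tutte–Grothendieck invariant if: (TG1) equivalent matroids have the same value under $f$; (TG2) if $e$ is a loop or an isthmus of $M$, then $f(M)=f(M(e))f(M-e)$; (TG3) for any atom $e$ that is neither a loop nor an isthmus of $M$, $f(M)=f(M-e)+f(M/e)$. $f$ is a $q$-Tutte–Grothendieck invariant on the class of matroids (the case $q=1$) if: ($q$-P1) $M_1\cong M_2$ implies $f(M_1)=f(M_2)$; ($q$-P2) if $M$ is prime-free, then $f(M)=f(M(e))f(M/e)$ for any atom $e\in\mathcal{L}$; ($q$-P3) if $M$ is not prime-free, and $e$ is an atom of $M$ that is independent and contained in every coloop of $M$, then $f(M)=f(M(e^c))+f(M/e)$. (In the Boolean case the proper interval decomposition appearing in the general axiom is $\mathcal{P}(e)=[e,\mathbf{1}]\,\dot\cup\,[\mathbf{0},e^c]$.) *)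

theory Defs
  imports "HOL-Library.FuncSet" "HOL-Computational_Algebra.Polynomial"
begin

section \<open>Matroids given by rank functions on Boolean lattices\<close>

definition rank_function :: "'a set \<Rightarrow> ('a set \<Rightarrow> nat) \<Rightarrow> bool" where
  "rank_function S r \<longleftrightarrow>
     (\<forall>x. x \<subseteq> S \<longrightarrow> r x \<le> card x) \<and>
     (\<forall>x y. x \<subseteq> y \<longrightarrow> y \<subseteq> S \<longrightarrow> r x \<le> r y) \<and>
     (\<forall>x y. x \<subseteq> S \<longrightarrow> y \<subseteq> S \<longrightarrow> r (x \<union> y) + r (x \<inter> y) \<le> r x + r y)"

text \<open>
  The lattice of a matroid is \<open>Pow S\<close>. Rank functions are required to be extensional, so
  that two values of the type are equal iff the ground sets are equal and the rank functions
  agree on \<open>Pow S\<close>; hence functions on the type are exactly functions on the class of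
  matroids whose ground set is a finite set of elements of \<open>'a\<close>.
\<close>

typedef 'a matroid =
  "{(S :: 'a set, r :: 'a set \<Rightarrow> nat).
      finite S \<and> rank_function S r \<and> r \<in> extensional (Pow S)}"
  by (rule exI[of _ "({}, restrict (\<lambda>_. 0) (Pow {}))"]) (auto simp: rank_function_def)

definition ground :: "'a matroid \<Rightarrow> 'a set" where
  "ground M = fst (Rep_matroid M)"

definition rank :: "'a matroid \<Rightarrow> 'a set \<Rightarrow> nat" where
  "rank M = snd (Rep_matroid M)"

text \<open>
  The minor on the interval \<open>[a, b]\<close>, transported to \<open>Pow (b - a)\<close> along
  \<open>x \<mapsto> x \<union> a\<close>. Only meaningful for \<open>a \<subseteq> b \<subseteq> ground M\<close>; the subtraction
  does not truncate there, by monotonicity.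
\<close>

definition minor :: "'a matroid \<Rightarrow> 'a set \<Rightarrow> 'a set \<Rightarrow> 'a matroid" where
  "minor M a b =
     Abs_matroid (b - a, restrict (\<lambda>x. rank M (x \<union> a) - rank M a) (Pow (b - a)))"

definition restriction :: "'a matroid \<Rightarrow> 'a set \<Rightarrow> 'a matroid" where
  "restriction M a = minor M {} a"

definition contraction :: "'a matroid \<Rightarrow> 'a set \<Rightarrow> 'a matroid" where
  "contraction M a = minor M a (ground M)"

definition deletion :: "'a matroid \<Rightarrow> 'a set \<Rightarrow> 'a matroid" where
  "deletion M a = minor M {} (ground M - a)"

definition equivalent :: "'a matroid \<Rightarrow> 'b matroid \<Rightarrow> bool" where
  "equivalent M N \<longleftrightarrow>
     (\<exists>\<phi>. bij_betw \<phi> (Pow (ground M)) (Pow (ground N)) \<and>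
          (\<forall>x\<in>Pow (ground M). \<forall>y\<in>Pow (ground M).
              \<phi> (x \<union> y) = \<phi> x \<union> \<phi> y \<and> \<phi> (x \<inter> y) = \<phi> x \<inter> \<phi> y) \<and>
          (\<forall>x\<in>Pow (ground M). rank M x = rank N (\<phi> x)))"

section \<open>Lattice elements and diamonds\<close>

definition atom :: "'a matroid \<Rightarrow> 'a set \<Rightarrow> bool" where
  "atom M x \<longleftrightarrow> (\<exists>s\<in>ground M. x = {s})"

definition coatom :: "'a matroid \<Rightarrow> 'a set \<Rightarrow> bool" where
  "coatom M x \<longleftrightarrow> (\<exists>s\<in>ground M. x = ground M - {s})"

definition independent :: "'a matroid \<Rightarrow> 'a set \<Rightarrow> bool" where
  "independent M x \<longleftrightarrow> x \<subseteq> ground M \<and> rank M x = card x"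

definition loop :: "'a matroid \<Rightarrow> 'a set \<Rightarrow> bool" where
  "loop M e \<longleftrightarrow> atom M e \<and> rank M e = 0"

definition isthmus :: "'a matroid \<Rightarrow> 'a set \<Rightarrow> bool" where
  "isthmus M e \<longleftrightarrow>
     atom M e \<and> (\<forall>y. y \<subseteq> ground M \<and> rank M y = rank M (ground M) \<longrightarrow> e \<subseteq> y)"

text \<open>
  A coloop is a coatom here, the complement of what is usually called a coloop. The rank
  condition is \<open>rank M x = rank M (ground M) - 1\<close>, written without truncated subtraction.
\<close>

definition coloop :: "'a matroid \<Rightarrow> 'a set \<Rightarrow> bool" where
  "coloop M x \<longleftrightarrow> coatom M x \<and> rank M x + 1 = rank M (ground M)"

definition diamond :: "'a matroid \<Rightarrow> 'a set \<Rightarrow> 'a set \<Rightarrow> bool" where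
  "diamond M a b \<longleftrightarrow> a \<subseteq> b \<and> b \<subseteq> ground M \<and> card (b - a) = 2"

definition prime_diamond :: "'a matroid \<Rightarrow> 'a set \<Rightarrow> 'a set \<Rightarrow> bool" where
  "prime_diamond M a b \<longleftrightarrow>
     diamond M a b \<and>
     (\<forall>x. a \<subset> x \<and> x \<subset> b \<longrightarrow> rank M x = rank M a + 1 \<and> rank M b = rank M x)"

definition prime_free :: "'a matroid \<Rightarrow> bool" where
  "prime_free M \<longleftrightarrow> \<not> (\<exists>a b. prime_diamond M a b)"

section \<open>Invariants\<close>

text \<open>The ring \<open>\<int>[x, y]\<close> is represented as \<open>\<int>[x][y]\<close>.\<close>

definition tutte_grothendieck :: "('a matroid \<Rightarrow> int poly poly) \<Rightarrow> bool" where
  "tutte_grothendieck f \<longleftrightarrow>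
     (\<forall>M N. equivalent M N \<longrightarrow> f M = f N) \<and>
     (\<forall>M e. loop M e \<or> isthmus M e \<longrightarrow> f M = f (restriction M e) * f (deletion M e)) \<and>
     (\<forall>M e. atom M e \<and> \<not> loop M e \<and> \<not> isthmus M e \<longrightarrow>
        f M = f (deletion M e) + f (contraction M e))"

definition q_tutte_grothendieck :: "('a matroid \<Rightarrow> int poly poly) \<Rightarrow> bool" where
  "q_tutte_grothendieck f \<longleftrightarrow>
     (\<forall>M N. equivalent M N \<longrightarrow> f M = f N) \<and>
     (\<forall>M e. prime_free M \<and> atom M e \<longrightarrow> f M = f (restriction M e) * f (contraction M e)) \<and>
     (\<forall>M e. \<not> prime_free M \<and> atom M e \<and> independent M e \<and> (\<forall>x. coloop M x \<longrightarrow> e \<subseteq> x) \<longrightarrow>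
        f M = f (restriction M (ground M - e)) + f (contraction M e))"

section \<open>Basic facts\<close>

lemma finite_ground: "finite (ground M)"
  using Rep_matroid[of M] by (auto simp: ground_def)

lemma rank_function_rank: "rank_function (ground M) (rank M)"
  using Rep_matroid[of M] by (auto simp: ground_def rank_def)

lemma rank_extensional: "rank M \<in> extensional (Pow (ground M))"
  using Rep_matroid[of M] by (auto simp: ground_def rank_def)

lemma rank_le_card: "x \<subseteq> ground M \<Longrightarrow> rank M x \<le> card x"
  using rank_function_rank[of M] by (simp add: rank_function_def)

lemma rank_mono: "x \<subseteq> y \<Longrightarrow> y \<subseteq> ground M \<Longrightarrow> rank M x \<le> rank M y"
  using rank_function_rank[of M] by (simp add: rank_function_def)

lemma rank_submodular:
  "x \<subseteq> ground M \<Longrightarrow> y \<subseteq> ground M \<Longrightarrow>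
     rank M (x \<union> y) + rank M (x \<inter> y) \<le> rank M x + rank M y"
  using rank_function_rank[of M] by (simp add: rank_function_def)

lemma matroid_eqI:
  assumes "ground M = ground N" and "\<And>x. x \<subseteq> ground M \<Longrightarrow> rank M x = rank N x"
  shows "M = N"
proof -
  have "rank M = rank N"
    using rank_extensional[of M] rank_extensional[of N] assms
    by (intro extensionalityI[of _ "Pow (ground M)"]) auto
  with assms(1) have "Rep_matroid M = Rep_matroid N"
    by (simp add: ground_def rank_def prod_eq_iff)
  then show ?thesis by (simp add: Rep_matroid_inject)
qed

lemma Rep_minor:
  assumes "a \<subseteq> b" "b \<subseteq> ground M"
  shows "Rep_matroid (minor M a b) =
    (b - a, restrict (\<lambda>x. rank M (x \<union> a) - rank M a) (Pow (b - a)))"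
proof -
  let ?r = "restrict (\<lambda>x. rank M (x \<union> a) - rank M a) (Pow (b - a))"
  have fin: "finite b" using assms(2) finite_ground finite_subset by blast
  have ge: "rank M a \<le> rank M (x \<union> a)" if "x \<subseteq> b - a" for x
    using that assms by (intro rank_mono) auto
  have "?r x \<le> card x" if x: "x \<subseteq> b - a" for x
  proof -
    have "rank M (x \<union> a) + rank M (x \<inter> a) \<le> rank M x + rank M a"
      using x assms by (intro rank_submodular) auto
    moreover have "rank M x \<le> card x" using x assms by (intro rank_le_card) auto
    ultimately show ?thesis using x by simp
  qed
  moreover have "?r x \<le> ?r y" if "x \<subseteq> y" "y \<subseteq> b - a" for x y
  proof -
    have "rank M (x \<union> a) \<le> rank M (y \<union> a)"
      using that assms by (intro rank_mono) auto
    moreover have "x \<subseteq> b - a" using that by blast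
    ultimately show ?thesis using that by (simp add: diff_le_mono)
  qed
  moreover have "?r (x \<union> y) + ?r (x \<inter> y) \<le> ?r x + ?r y" if "x \<subseteq> b - a" "y \<subseteq> b - a" for x y
  proof -
    have "(x \<union> a) \<union> (y \<union> a) = (x \<union> y) \<union> a" "(x \<union> a) \<inter> (y \<union> a) = (x \<inter> y) \<union> a" by auto
    moreover have "rank M ((x \<union> a) \<union> (y \<union> a)) + rank M ((x \<union> a) \<inter> (y \<union> a))
        \<le> rank M (x \<union> a) + rank M (y \<union> a)"
      using that assms by (intro rank_submodular) auto
    moreover have "x \<union> y \<subseteq> b - a" "x \<inter> y \<subseteq> b - a" using that by auto
    ultimately show ?thesis
      using that ge[of "x \<union> y"] ge[of "x \<inter> y"] ge[of x] ge[of y] by simp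
  qed
  ultimately have "rank_function (b - a) ?r"
    unfolding rank_function_def by blast
  then show ?thesis
    unfolding minor_def using fin by (intro Abs_matroid_inverse) auto
qed

lemma ground_minor: "a \<subseteq> b \<Longrightarrow> b \<subseteq> ground M \<Longrightarrow> ground (minor M a b) = b - a"
  by (simp add: ground_def[of "minor M a b"] Rep_minor)

lemma rank_minor:
  "a \<subseteq> b \<Longrightarrow> b \<subseteq> ground M \<Longrightarrow> x \<subseteq> b - a \<Longrightarrow>
     rank (minor M a b) x = rank M (x \<union> a) - rank M a"
  by (simp add: rank_def[of "minor M a b"] Rep_minor)

end

theory Submission
  imports Defs
begin

text \<open>
  Call a point \<open>s\<close> of a matroid a separator if adding it to a set not containing it always
  raises the rank by \<open>r {s}\<close>, i.e. if the matroid is the direct sum of its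
  restrictions to \<open>{s}\<close> and to the complement of \<open>s\<close>. By diminishing returns, the
  separators are exactly the loops and isthmuses, and deleting a separator has the same effect as
  contracting it (\<open>loop_or_isthmus_iff_separator\<close>, \<open>contraction_separator\<close>).

  The two sets of axioms are linked by the fact that a prime diamond is a minor of type
  \<open>U\<^sub>1\<^sub>2\<close> (rank one, two
  points, no loop), and that such a minor exists iff some point is not a separator
  (\<open>prime_free_iff\<close>). Consequently the second \<open>q\<close>-axiom is the multiplicative axiom for
  loops and isthmuses, restricted to matroids consisting of separators only. The
  additive axioms agree outright: the coloop condition on an independent atom says that it is not an
  isthmus, and the presence of a point that is not a separator already excludes prime-freeness.

  What remains is to derive multiplicativity at a separator \<open>e\<close> of a matroid that is not
  prime-free (\<open>multiplicative_at_separator\<close>). Such a matroid has a point \<open>a\<close> that is not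
  a separator. Expanding \<open>f M\<close> by deletion and contraction of \<open>a\<close>, splitting off \<open>e\<close>
  from both terms by induction on the size of the ground set, and reassembling the expansion of
  \<open>f (M - e)\<close> at \<open>a\<close> gives the claim, since minors at \<open>a\<close> and \<open>e\<close> commute.
\<close>

section \<open>Separators\<close>

definition separator :: "'a matroid \<Rightarrow> 'a \<Rightarrow> bool" where
  "separator M s \<longleftrightarrow> s \<in> ground M \<and>
     (\<forall>X. X \<subseteq> ground M - {s} \<longrightarrow> rank M (insert s X) = rank M X + rank M {s})"

lemma separator_in_ground: "separator M s \<Longrightarrow> s \<in> ground M"
  by (simp only: separator_def)

lemma rank_insert_separator:
  "separator M s \<Longrightarrow> X \<subseteq> ground M - {s} \<Longrightarrow> rank M (insert s X) = rank M X + rank M {s}"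
  unfolding separator_def by blast

lemma rank_empty: "rank M {} = 0"
  using rank_le_card[of "{}" M] by simp

lemma rank_singleton_le: "s \<in> ground M \<Longrightarrow> rank M {s} \<le> 1"
  using rank_le_card[of "{s}" M] by simp

lemma rank_insert_diminishing:
  assumes "X \<subseteq> Y" "Y \<subseteq> ground M - {s}" "s \<in> ground M"
  shows "rank M (insert s Y) + rank M X \<le> rank M (insert s X) + rank M Y"
proof -
  have "insert s X \<union> Y = insert s Y" "insert s X \<inter> Y = X" using assms by auto
  then show ?thesis
    using rank_submodular[of "insert s X" M Y] assms by auto
qed

lemma rank_insert_le:
  assumes "Y \<subseteq> ground M - {s}" "s \<in> ground M"
  shows "rank M (insert s Y) \<le> rank M Y + rank M {s}"
  using rank_insert_diminishing[of "{}" Y M s] assms by (simp add: rank_empty)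

lemma atom_singleton: "atom M {s} \<longleftrightarrow> s \<in> ground M"
  by (simp add: atom_def)

lemma rank_ground_le:
  assumes "s \<in> ground M"
  shows "rank M (ground M) \<le> rank M (ground M - {s}) + 1"
  using rank_insert_le[of "ground M - {s}" M s] rank_singleton_le[OF assms] assms
  by (simp add: insert_absorb)

lemma isthmus_iff_rank_drop:
  "isthmus M {s} \<longleftrightarrow> s \<in> ground M \<and> rank M (ground M - {s}) + 1 = rank M (ground M)"
proof (cases "s \<in> ground M")
  case True
  then have le: "rank M (ground M) \<le> rank M (ground M - {s}) + 1"
    by (rule rank_ground_le)
  have "isthmus M {s} \<longleftrightarrow> rank M (ground M - {s}) < rank M (ground M)"
  proof
    assume "isthmus M {s}"
    then have "rank M (ground M - {s}) \<noteq> rank M (ground M)"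
      unfolding isthmus_def by blast
    moreover have "rank M (ground M - {s}) \<le> rank M (ground M)" by (rule rank_mono) auto
    ultimately show "rank M (ground M - {s}) < rank M (ground M)" by simp
  next
    assume less: "rank M (ground M - {s}) < rank M (ground M)"
    have "s \<in> y" if y: "y \<subseteq> ground M" "rank M y = rank M (ground M)" for y
    proof (rule ccontr)
      assume "s \<notin> y"
      then have "rank M y \<le> rank M (ground M - {s})" using y by (intro rank_mono) auto
      with less y show False by simp
    qed
    then show "isthmus M {s}" using True by (simp add: isthmus_def atom_singleton)
  qed
  with le True show ?thesis by auto
qed (auto simp: isthmus_def atom_singleton)

text \<open>
  By diminishing returns, the rank increase caused by \<open>s\<close> lies between its value at
  the complement of \<open>s\<close> and its value at \<open>\<emptyset>\<close>. It is therefore constant as soon as it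
  is \<open>0\<close> at \<open>\<emptyset>\<close> (a loop) or \<open>1\<close> at the complement (an isthmus).
\<close>

lemma loop_or_isthmus_iff_separator: "loop M {s} \<or> isthmus M {s} \<longleftrightarrow> separator M s"
proof
  assume *: "loop M {s} \<or> isthmus M {s}"
  then have s: "s \<in> ground M" by (auto simp: loop_def isthmus_def atom_singleton)
  have "rank M (insert s X) = rank M X + rank M {s}" if X: "X \<subseteq> ground M - {s}" for X
  proof -
    have up: "rank M (insert s X) \<le> rank M X + rank M {s}"
      using X s by (rule rank_insert_le)
    from * show ?thesis
    proof
      assume "loop M {s}"
      moreover have "rank M X \<le> rank M (insert s X)" using X s by (intro rank_mono) auto
      ultimately show ?thesis using up by (simp add: loop_def)
    next
      assume "isthmus M {s}"
      then have "rank M (ground M - {s}) + 1 = rank M (ground M)"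
        by (simp add: isthmus_iff_rank_drop)
      then have "rank M X + 1 \<le> rank M (insert s X)"
        using rank_insert_diminishing[OF X subset_refl s] by (simp add: insert_absorb[OF s])
      with up rank_singleton_le[OF s] show ?thesis by simp
    qed
  qed
  with s show "separator M s" unfolding separator_def by blast
next
  assume sep: "separator M s"
  then have s: "s \<in> ground M" by (rule separator_in_ground)
  have "rank M (insert s (ground M - {s})) = rank M (ground M - {s}) + rank M {s}"
    by (intro rank_insert_separator[OF sep]) simp
  then have "rank M (ground M) = rank M (ground M - {s}) + rank M {s}"
    using s by (simp add: insert_absorb)
  moreover have "rank M {s} = 0 \<or> rank M {s} = 1"
    using rank_singleton_le[OF s] by linarith
  ultimately show "loop M {s} \<or> isthmus M {s}"
    using s by (auto simp: isthmus_iff_rank_drop loop_def atom_singleton)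
qed

lemma not_separator_iff:
  assumes "s \<in> ground M"
  shows "\<not> separator M s \<longleftrightarrow>
    rank M {s} = 1 \<and> rank M (ground M - {s}) = rank M (ground M)"
proof -
  have "rank M (ground M - {s}) \<le> rank M (ground M)" by (rule rank_mono) auto
  then have "isthmus M {s} \<longleftrightarrow> rank M (ground M - {s}) \<noteq> rank M (ground M)"
    using rank_ground_le[OF assms] assms unfolding isthmus_iff_rank_drop by auto
  moreover have "loop M {s} \<longleftrightarrow> rank M {s} \<noteq> 1"
    using rank_singleton_le[OF assms] assms by (auto simp: loop_def atom_singleton)
  ultimately show ?thesis unfolding loop_or_isthmus_iff_separator[symmetric] by blast
qed

section \<open>Prime diamonds\<close>

lemma prime_diamondI:
  assumes "A \<subseteq> ground M" "s \<in> ground M - A" "t \<in> ground M - A" "s \<noteq> t"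
    and "rank M (insert s A) = rank M A + 1" "rank M (insert t A) = rank M A + 1"
    and "rank M (insert s (insert t A)) = rank M A + 1"
  shows "prime_diamond M A (insert s (insert t A))"
proof -
  have "insert s (insert t A) - A = {s, t}" using assms by auto
  then have "diamond M A (insert s (insert t A))"
    using assms by (auto simp: diamond_def)
  moreover have "x = insert s A \<or> x = insert t A"
    if "A \<subset> x" "x \<subset> insert s (insert t A)" for x
    using that by blast
  ultimately show ?thesis
    unfolding prime_diamond_def using assms by metis
qed

text \<open>
  If \<open>s\<close> is not a separator, then adding it raises the rank of \<open>\<emptyset>\<close> but not that of
  its complement. A prime diamond sits where this behaviour changes: its bottom is a maximal set
  \<open>A\<close> whose rank is raised by \<open>s\<close>, and its other direction is any further point.
\<close>

lemma prime_free_iff: "prime_free M \<longleftrightarrow> (\<forall>s\<in>ground M. separator M s)"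
proof
  assume pf: "prime_free M"
  show "\<forall>s\<in>ground M. separator M s"
  proof (rule ballI, rule ccontr)
    fix s assume s: "s \<in> ground M" and "\<not> separator M s"
    then have r1: "rank M {s} = 1" and rS: "rank M (ground M - {s}) = rank M (ground M)"
      using not_separator_iff[OF s] by auto
    have insS: "insert s (ground M - {s}) = ground M" using s by blast
    let ?F = "{A. A \<subseteq> ground M - {s} \<and> rank M (insert s A) = rank M A + 1}"
    have "?F \<subseteq> Pow (ground M)" by auto
    moreover have "finite (Pow (ground M))" by (simp add: finite_ground)
    ultimately have "finite ?F" by (rule finite_subset)
    moreover have "{} \<in> ?F" by (simp add: r1 rank_empty)
    then have "?F \<noteq> {}" by blast
    ultimately have "\<exists>A\<in>?F. \<forall>B\<in>?F. A \<subseteq> B \<longrightarrow> A = B" by (rule finite_has_maximal)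
    then obtain A where "A \<in> ?F" and "\<forall>B\<in>?F. A \<subseteq> B \<longrightarrow> A = B" by (rule bexE)
    then have A: "A \<subseteq> ground M - {s}" "rank M (insert s A) = rank M A + 1"
      and max: "\<And>B. B \<subseteq> ground M - {s} \<Longrightarrow> rank M (insert s B) = rank M B + 1
                  \<Longrightarrow> A \<subseteq> B \<Longrightarrow> A = B"
      by auto
    have "A \<noteq> ground M - {s}" using A(2) rS insS by force
    then obtain t where t: "t \<in> ground M" "t \<noteq> s" "t \<notin> A" using A(1) by blast
    let ?B = "insert t A"
    have B: "?B \<subseteq> ground M - {s}" using A t by auto
    have "rank M (insert s ?B) \<noteq> rank M ?B + 1" using max[OF B] t(3)
      by (metis insertI1 subset_insertI)
    moreover have "rank M (insert s ?B) \<le> rank M ?B + 1"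
      using rank_insert_le[OF B s] r1 by simp
    moreover have "rank M ?B \<le> rank M A + 1"
    proof -
      have "A \<subseteq> ground M - {t}" using A(1) t(3) by auto
      then show ?thesis using rank_insert_le[of A M t] t(1) rank_singleton_le[OF t(1)] by linarith
    qed
    moreover have "rank M (insert s A) \<le> rank M (insert s ?B)"
      using B s by (intro rank_mono) auto
    ultimately have "rank M ?B = rank M A + 1" "rank M (insert s ?B) = rank M A + 1"
      using A(2) by linarith+
    then have "prime_diamond M A (insert s ?B)"
      using A s t by (intro prime_diamondI) auto
    with pf show False by (auto simp: prime_free_def)
  qed
next
  assume sep: "\<forall>s\<in>ground M. separator M s"
  show "prime_free M"
    unfolding prime_free_def
  proof
    assume "\<exists>a b. prime_diamond M a b"
    then obtain a b where "prime_diamond M a b" by (elim exE)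
    then have d: "diamond M a b"
      and p: "\<forall>x. a \<subset> x \<and> x \<subset> b \<longrightarrow> rank M x = rank M a + 1 \<and> rank M b = rank M x"
      unfolding prime_diamond_def by (rule conjunct1, rule conjunct2)
    from d obtain s t where st: "b - a = {s, t}" "s \<noteq> t"
      by (auto simp: diamond_def card_2_iff)
    moreover have ab: "a \<subseteq> b" "b \<subseteq> ground M" using d by (auto simp: diamond_def)
    ultimately have b: "b = insert s (insert t a)" "s \<notin> a" "t \<notin> a" "b \<subseteq> ground M"
      by blast+
    have "a \<subset> insert s a \<and> insert s a \<subset> b" "a \<subset> insert t a \<and> insert t a \<subset> b"
      using b st(2) by auto
    from this[THEN p[rule_format]] have "rank M (insert s a) = rank M a + 1" "rank M b = rank M (insert t a)"
      by blast+
    moreover have "separator M s" using sep b by simp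
    then have "rank M (insert s a) = rank M a + rank M {s}"
      "rank M (insert s (insert t a)) = rank M (insert t a) + rank M {s}"
      using b st(2) by (intro rank_insert_separator; auto)+
    ultimately show False unfolding b(1) by linarith
  qed
qed

section \<open>Minors at a point\<close>

lemma ground_deletion [simp]: "ground (deletion M x) = ground M - x"
  by (simp add: deletion_def ground_minor)

lemma rank_deletion: "X \<subseteq> ground M - x \<Longrightarrow> rank (deletion M x) X = rank M X"
  by (simp add: deletion_def rank_minor rank_empty)

lemma ground_contraction [simp]: "x \<subseteq> ground M \<Longrightarrow> ground (contraction M x) = ground M - x"
  by (simp add: contraction_def ground_minor)

lemma rank_contraction:
  "x \<subseteq> ground M \<Longrightarrow> X \<subseteq> ground M - x \<Longrightarrow>
    rank (contraction M x) X = rank M (X \<union> x) - rank M x"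
  by (simp add: contraction_def rank_minor)

lemma ground_restriction [simp]: "x \<subseteq> ground M \<Longrightarrow> ground (restriction M x) = x"
  by (simp add: restriction_def ground_minor)

lemma rank_restriction: "x \<subseteq> ground M \<Longrightarrow> X \<subseteq> x \<Longrightarrow> rank (restriction M x) X = rank M X"
  by (simp add: restriction_def rank_minor rank_empty)

lemma deletion_eq_restriction: "deletion M x = restriction M (ground M - x)"
  by (simp add: deletion_def restriction_def)

lemma contraction_separator:
  assumes "separator M e"
  shows "contraction M {e} = deletion M {e}"
proof (rule matroid_eqI)
  have e: "e \<in> ground M" using assms by (rule separator_in_ground)
  then show "ground (contraction M {e}) = ground (deletion M {e})" by simp
  fix X assume "X \<subseteq> ground (contraction M {e})"
  then have "X \<subseteq> ground M - {e}" using e by simp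
  then show "rank (contraction M {e}) X = rank (deletion M {e}) X"
    using e rank_insert_separator[OF assms, of X] by (simp add: rank_contraction rank_deletion)
qed

lemma deletion_deletion: "deletion (deletion M x) y = deletion M (x \<union> y)"
proof (rule matroid_eqI)
  show "ground (deletion (deletion M x) y) = ground (deletion M (x \<union> y))" by auto
  fix X assume "X \<subseteq> ground (deletion (deletion M x) y)"
  then have "X \<subseteq> ground M - x - y" by simp
  then have "X \<subseteq> ground (deletion M x) - y" "X \<subseteq> ground M - x" "X \<subseteq> ground M - (x \<union> y)"
    by auto
  then show "rank (deletion (deletion M x) y) X = rank (deletion M (x \<union> y)) X"
    by (simp only: rank_deletion)
qed

lemma contraction_deletion_commute:
  assumes "x \<subseteq> ground M" "y \<subseteq> ground M" "x \<inter> y = {}"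
  shows "contraction (deletion M y) x = deletion (contraction M x) y"
proof (rule matroid_eqI)
  have sub: "x \<subseteq> ground M - y" using assms by blast
  show "ground (contraction (deletion M y) x) = ground (deletion (contraction M x) y)"
    using assms sub by auto
  fix X assume "X \<subseteq> ground (contraction (deletion M y) x)"
  then have X: "X \<subseteq> ground M - y - x" using sub by simp
  then have "X \<union> x \<subseteq> ground M - y" "X \<subseteq> ground M - x - y" "X \<subseteq> ground M - x"
    using sub by auto
  then show "rank (contraction (deletion M y) x) X = rank (deletion (contraction M x) y) X"
    using assms sub X by (auto simp: rank_contraction rank_deletion)
qed

lemma restriction_deletion:
  assumes "x \<subseteq> ground M - y"
  shows "restriction (deletion M y) x = restriction M x"
proof -
  have "x \<subseteq> ground M" using assms by blast
  then show ?thesis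
    using assms by (intro matroid_eqI) (auto simp: rank_restriction rank_deletion)
qed

lemma restriction_contraction_separator:
  assumes e: "separator M e" and a: "a \<in> ground M" "a \<noteq> e"
  shows "restriction (contraction M {a}) {e} = restriction M {e}"
proof (rule matroid_eqI)
  have eg: "e \<in> ground M" using e by (rule separator_in_ground)
  then show "ground (restriction (contraction M {a}) {e}) = ground (restriction M {e})"
    using a by simp
  fix X assume "X \<subseteq> ground (restriction (contraction M {a}) {e})"
  then have X: "X \<subseteq> {e}" using eg a by simp
  have "rank M {e, a} = rank M {a} + rank M {e}"
    using e a by (intro rank_insert_separator) auto
  then show "rank (restriction (contraction M {a}) {e}) X = rank (restriction M {e}) X"
    using X eg a by (auto simp: rank_restriction rank_contraction rank_empty
        subset_singleton_iff insert_commute)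
qed

lemma separator_deletion:
  assumes "separator M e" "a \<noteq> e"
  shows "separator (deletion M {a}) e"
  unfolding separator_def
proof (intro conjI allI impI)
  have e: "e \<in> ground M" using assms(1) by (rule separator_in_ground)
  then show "e \<in> ground (deletion M {a})" using assms(2) by simp
  fix X assume "X \<subseteq> ground (deletion M {a}) - {e}"
  then have X: "X \<subseteq> ground M - {a} - {e}" by simp
  then have "rank M (insert e X) = rank M X + rank M {e}"
    by (intro rank_insert_separator[OF assms(1)]) auto
  moreover have "insert e X \<subseteq> ground M - {a}" "X \<subseteq> ground M - {a}" "{e} \<subseteq> ground M - {a}"
    using X e assms(2) by auto
  ultimately show "rank (deletion M {a}) (insert e X) =
      rank (deletion M {a}) X + rank (deletion M {a}) {e}"
    by (simp only: rank_deletion)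
qed

lemma separator_contraction:
  assumes e: "separator M e" and a: "a \<in> ground M" "a \<noteq> e"
  shows "separator (contraction M {a}) e"
  unfolding separator_def
proof (intro conjI allI impI)
  have eg: "e \<in> ground M" using e by (rule separator_in_ground)
  then show "e \<in> ground (contraction M {a})" using a by simp
  fix X assume "X \<subseteq> ground (contraction M {a}) - {e}"
  then have X: "X \<subseteq> ground M - {a} - {e}" using a by simp
  have "rank M {a} \<le> rank M (insert a X)" using X a by (intro rank_mono) auto
  moreover have "rank M (insert e (insert a X)) = rank M (insert a X) + rank M {e}"
    using X a by (intro rank_insert_separator[OF e]) auto
  moreover have "rank M {e, a} = rank M {a} + rank M {e}"
    using a by (intro rank_insert_separator[OF e]) auto
  moreover have "insert e X \<subseteq> ground M - {a}" "X \<subseteq> ground M - {a}" "{e} \<subseteq> ground M - {a}"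
    using X eg a(2) by auto
  ultimately show "rank (contraction M {a}) (insert e X) =
      rank (contraction M {a}) X + rank (contraction M {a}) {e}"
    using a(1) by (simp add: rank_contraction insert_commute)
qed

text \<open>
  Needed to expand \<open>f (M - e)\<close> at \<open>a\<close>: since \<open>e\<close> is a direct summand, removing it
  changes the rank of the ground set and of the complement of \<open>a\<close> by the same amount, so \<open>a\<close>
  does not become an isthmus.
\<close>

lemma not_separator_deletion_separator:
  assumes e: "separator M e" and a: "a \<in> ground M" "\<not> separator M a"
  shows "\<not> separator (deletion M {e}) a"
proof -
  have eg: "e \<in> ground M" using e by (rule separator_in_ground)
  have ae: "a \<noteq> e" using e a by blast
  have sep: "rank M (insert e Y) = rank M Y + rank M {e}" if "Y \<subseteq> ground M - {e}" for Y
    using e that by (rule rank_insert_separator)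
  have r: "rank M {a} = 1" "rank M (ground M - {a}) = rank M (ground M)"
    using a(2) not_separator_iff[OF a(1)] by auto
  have "insert e (ground M - {e}) = ground M" "insert e (ground M - {e} - {a}) = ground M - {a}"
    using eg ae by auto
  then have "rank M (ground M - {e} - {a}) = rank M (ground M - {e})"
    using sep[of "ground M - {e}"] sep[of "ground M - {e} - {a}"] r(2) by auto
  then show ?thesis
    using r a ae by (subst not_separator_iff) (auto simp: rank_deletion)
qed

section \<open>Comparing the axioms\<close>

text \<open>
  The induction is over the whole class of matroids at once, because it passes to the deletion and
  the contraction of a point \<open>a\<close> that is not a separator. The factor \<open>f (M(e))\<close> is common to
  both terms, since the restriction to \<open>e\<close> is unaffected by either operation.
\<close>

lemma multiplicative_at_separator:
  fixes f :: "'a matroid \<Rightarrow> 'b::comm_semiring_1"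
  assumes prime_free: "\<And>M e. prime_free M \<Longrightarrow> e \<in> ground M \<Longrightarrow>
      f M = f (restriction M {e}) * f (contraction M {e})"
    and del_contr: "\<And>M a. a \<in> ground M \<Longrightarrow> \<not> separator M a \<Longrightarrow>
      f M = f (deletion M {a}) + f (contraction M {a})"
    and "separator M e"
  shows "f M = f (restriction M {e}) * f (deletion M {e})"
  using \<open>separator M e\<close>
proof (induction "card (ground M)" arbitrary: M rule: less_induct)
  case less
  note e = less.prems
  then have eg: "e \<in> ground M" by (rule separator_in_ground)
  show ?case
  proof (cases "prime_free M")
    case True
    then show ?thesis
      using prime_free[OF True eg] contraction_separator[OF e] by simp
  next
    case False
    then obtain a where a: "a \<in> ground M" "\<not> separator M a"
      by (auto simp: prime_free_iff)
    then have ae: "a \<noteq> e" using e by blast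
    have smaller: "card (ground M - {a}) < card (ground M)"
      using a finite_ground by (metis card_Diff1_less)
    let ?D = "deletion M {a}" and ?C = "contraction M {a}"
    have "f ?D = f (restriction ?D {e}) * f (deletion ?D {e})"
      using smaller separator_deletion[OF e ae] by (intro less.hyps) auto
    moreover have "restriction ?D {e} = restriction M {e}"
      using eg ae by (intro restriction_deletion) auto
    moreover have "deletion ?D {e} = deletion (deletion M {e}) {a}"
      by (simp add: deletion_deletion insert_commute)
    moreover have "f ?C = f (restriction ?C {e}) * f (deletion ?C {e})"
      using smaller a separator_contraction[OF e a(1) ae] by (intro less.hyps) auto
    moreover have "restriction ?C {e} = restriction M {e}"
      using restriction_contraction_separator[OF e a(1) ae] .
    moreover have "deletion ?C {e} = contraction (deletion M {e}) {a}"
      using eg a ae by (intro contraction_deletion_commute[symmetric]) auto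
    moreover have "f (deletion M {e}) =
        f (deletion (deletion M {e}) {a}) + f (contraction (deletion M {e}) {a})"
      using a ae not_separator_deletion_separator[OF e a] by (intro del_contr) auto
    ultimately show ?thesis
      using del_contr[OF a] by (simp add: distrib_left)
  qed
qed

lemma independent_below_coloops_iff:
  "independent M {s} \<and> (\<forall>x. coloop M x \<longrightarrow> {s} \<subseteq> x) \<longleftrightarrow> \<not> separator M s"
  if s: "s \<in> ground M"
proof -
  have "isthmus M {s} \<longleftrightarrow> coloop M (ground M - {s})"
    using s by (auto simp: isthmus_iff_rank_drop coloop_def coatom_def)
  \<comment> \<open>The complement of \<open>s\<close> is the only coatom that does not contain \<open>s\<close>.\<close>
  moreover have "(\<forall>x. coloop M x \<longrightarrow> {s} \<subseteq> x) \<longleftrightarrow> \<not> coloop M (ground M - {s})"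
    using s by (auto simp: coloop_def coatom_def)
  moreover have "independent M {s} \<longleftrightarrow> \<not> loop M {s}"
    using s rank_singleton_le[OF s] by (auto simp: independent_def loop_def atom_singleton)
  ultimately show ?thesis using loop_or_isthmus_iff_separator by metis
qed

lemma tutte_grothendieck_iff_separator:
  "tutte_grothendieck f \<longleftrightarrow>
     (\<forall>M N. equivalent M N \<longrightarrow> f M = f N) \<and>
     (\<forall>M e. separator M e \<longrightarrow> f M = f (restriction M {e}) * f (deletion M {e})) \<and>
     (\<forall>M e. e \<in> ground M \<and> \<not> separator M e \<longrightarrow>
        f M = f (deletion M {e}) + f (contraction M {e}))"
proof -
  have "(\<forall>M e. loop M e \<or> isthmus M e \<longrightarrow> f M = f (restriction M e) * f (deletion M e)) \<longleftrightarrow>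
    (\<forall>M e. separator M e \<longrightarrow> f M = f (restriction M {e}) * f (deletion M {e}))"
    unfolding loop_or_isthmus_iff_separator[symmetric]
    by (auto simp: loop_def isthmus_def atom_def)
  moreover have "(\<forall>M e. atom M e \<and> \<not> loop M e \<and> \<not> isthmus M e \<longrightarrow>
        f M = f (deletion M e) + f (contraction M e)) \<longleftrightarrow>
     (\<forall>M e. e \<in> ground M \<and> \<not> separator M e \<longrightarrow>
        f M = f (deletion M {e}) + f (contraction M {e}))"
    unfolding loop_or_isthmus_iff_separator[symmetric] by (auto simp: atom_def)
  ultimately show ?thesis unfolding tutte_grothendieck_def by simp
qed

lemma q_tutte_grothendieck_iff_separator:
  "q_tutte_grothendieck f \<longleftrightarrow>
     (\<forall>M N. equivalent M N \<longrightarrow> f M = f N) \<and>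
     (\<forall>M e. prime_free M \<and> e \<in> ground M \<longrightarrow>
        f M = f (restriction M {e}) * f (contraction M {e})) \<and>
     (\<forall>M e. e \<in> ground M \<and> \<not> separator M e \<longrightarrow>
        f M = f (deletion M {e}) + f (contraction M {e}))"
proof -
  have "(\<forall>M e. prime_free M \<and> atom M e \<longrightarrow> f M = f (restriction M e) * f (contraction M e)) \<longleftrightarrow>
    (\<forall>M e. prime_free M \<and> e \<in> ground M \<longrightarrow>
        f M = f (restriction M {e}) * f (contraction M {e}))"
    by (auto simp: atom_def)
  moreover have "\<not> prime_free M \<and> atom M e \<and> independent M e \<and> (\<forall>x. coloop M x \<longrightarrow> e \<subseteq> x) \<longleftrightarrow>
      (\<exists>s\<in>ground M. e = {s} \<and> \<not> separator M s)" for M :: "'a matroid" and e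
    using independent_below_coloops_iff[of _ M] by (auto simp: atom_def prime_free_iff)
  then have "(\<forall>M e. \<not> prime_free M \<and> atom M e \<and> independent M e \<and>
        (\<forall>x. coloop M x \<longrightarrow> e \<subseteq> x) \<longrightarrow>
        f M = f (restriction M (ground M - e)) + f (contraction M e)) \<longleftrightarrow>
     (\<forall>M e. e \<in> ground M \<and> \<not> separator M e \<longrightarrow>
        f M = f (deletion M {e}) + f (contraction M {e}))"
    unfolding deletion_eq_restriction by (simp only:) blast
  ultimately show ?thesis unfolding q_tutte_grothendieck_def by simp
qed

theorem theorem91:
  fixes f :: "'a matroid \<Rightarrow> int poly poly"
  shows "q_tutte_grothendieck f \<longleftrightarrow> tutte_grothendieck f"
proof
  assume "q_tutte_grothendieck f"
  then have equiv: "\<forall>M N. equivalent M N \<longrightarrow> f M = f N"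
    and pf: "prime_free M \<Longrightarrow> e \<in> ground M \<Longrightarrow>
      f M = f (restriction M {e}) * f (contraction M {e})"
    and dc: "e \<in> ground M \<Longrightarrow> \<not> separator M e \<Longrightarrow>
      f M = f (deletion M {e}) + f (contraction M {e})" for M e
    unfolding q_tutte_grothendieck_iff_separator by blast+
  have "f M = f (restriction M {e}) * f (deletion M {e})" if "separator M e" for M e
    using pf dc that by (rule multiplicative_at_separator)
  with equiv dc show "tutte_grothendieck f"
    unfolding tutte_grothendieck_iff_separator by blast
next
  assume "tutte_grothendieck f"
  then have equiv: "\<forall>M N. equivalent M N \<longrightarrow> f M = f N"
    and sep: "separator M e \<Longrightarrow> f M = f (restriction M {e}) * f (deletion M {e})"
    and dc: "e \<in> ground M \<Longrightarrow> \<not> separator M e \<Longrightarrow>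
      f M = f (deletion M {e}) + f (contraction M {e})" for M e
    unfolding tutte_grothendieck_iff_separator by blast+
  have "f M = f (restriction M {e}) * f (contraction M {e})"
    if "prime_free M" "e \<in> ground M" for M e
  proof -
    have e: "separator M e" using that unfolding prime_free_iff by blast
    show ?thesis unfolding contraction_separator[OF e] by (rule sep[OF e])
  qed
  with equiv dc show "q_tutte_grothendieck f"
    unfolding q_tutte_grothendieck_iff_separator by blast
qed

end
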